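(* Let $M$ be an E-unitary inverse monoid and let $N$ be an inverse submonoid of $M$. Suppose that at least one of the following holds: (1) $N \subseteq U_M$; (2) $N \subseteq E_M$; (3) $N$ is the inverse submonoid of $M$ generated by a single element $r \in R_M$; (4) $N$ is the inverse submonoid of $M$ generated by a single element $l \in L_M$. Then $N$ is upwardly directed into $M$.
   Context: For an inverse monoid $M$: $E_M$ is the set of idempotents; $R_M = \{m \in M : mm^{-1}=1\}$ is the set of right units; $L_M=\{m \in M : m^{-1}m=1\}$ is the set of left units; $U_M = R_M \cap L_M$ is the group of units. Inverse submonoids contain the identity of $M$ and are closed under products and inverses. Let $\sigma$ be the minimum group congruence on $M$ (the smallest congruence such that $M/\sigma$ is a group); $M$ is E-unitary if an element of $M$ is $\sigma$-related to $1$ if and only if it is idempotent. The natural partial order on $M$ is: $x \le y$ iff $x = ye$ for some $e \in E_M$ (equivalently $x = fy$ for some $f \in E_M$). The meet $x \wedge y$ is the greatest lower bound of $x$ and $y$ in this order; it need not exist. A subset $N$ of $M$ that is an inverse subsemigroup is upwardly directed into $M$ if for all $s \in M$ and $u \in N$ such that $s \wedge u$ is defined, there exists $v \in N \cup \{1\}$ with $s \le v$ and $u \le v$. *)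

theory Defs
  imports "HOL-Algebra.Coset" "HOL-Algebra.Order"
begin

definition is_sinv :: "('a, 'b) monoid_scheme \<Rightarrow> 'a \<Rightarrow> 'a \<Rightarrow> bool" where
  "is_sinv M x y \<longleftrightarrow> y \<in> carrier M \<and> x \<otimes>\<^bsub>M\<^esub> y \<otimes>\<^bsub>M\<^esub> x = x \<and> y \<otimes>\<^bsub>M\<^esub> x \<otimes>\<^bsub>M\<^esub> y = y"

locale inverse_monoid = monoid M for M (structure) +
  assumes ex1_sinv: "x \<in> carrier M \<Longrightarrow> \<exists>!y. is_sinv M x y"

text \<open>The inverse in the sense of inverse semigroups; \<open>m_inv\<close> of the library is the
  group-theoretic inverse, which is only meaningful on units.\<close>

definition sinv :: "('a, 'b) monoid_scheme \<Rightarrow> 'a \<Rightarrow> 'a" where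
  "sinv M x = (THE y. is_sinv M x y)"

definition idems :: "('a, 'b) monoid_scheme \<Rightarrow> 'a set" where
  "idems M = {e \<in> carrier M. e \<otimes>\<^bsub>M\<^esub> e = e}"

definition right_units :: "('a, 'b) monoid_scheme \<Rightarrow> 'a set" where
  "right_units M = {m \<in> carrier M. m \<otimes>\<^bsub>M\<^esub> sinv M m = \<one>\<^bsub>M\<^esub>}"

definition left_units :: "('a, 'b) monoid_scheme \<Rightarrow> 'a set" where
  "left_units M = {m \<in> carrier M. sinv M m \<otimes>\<^bsub>M\<^esub> m = \<one>\<^bsub>M\<^esub>}"

definition two_sided_units :: "('a, 'b) monoid_scheme \<Rightarrow> 'a set" where
  "two_sided_units M = right_units M \<inter> left_units M"

definition inverse_subsemigroup :: "'a set \<Rightarrow> ('a, 'b) monoid_scheme \<Rightarrow> bool" where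
  "inverse_subsemigroup N M \<longleftrightarrow> N \<subseteq> carrier M \<and>
     (\<forall>x\<in>N. \<forall>y\<in>N. x \<otimes>\<^bsub>M\<^esub> y \<in> N) \<and> (\<forall>x\<in>N. sinv M x \<in> N)"

definition inverse_submonoid :: "'a set \<Rightarrow> ('a, 'b) monoid_scheme \<Rightarrow> bool" where
  "inverse_submonoid N M \<longleftrightarrow> inverse_subsemigroup N M \<and> \<one>\<^bsub>M\<^esub> \<in> N"

definition inverse_submonoid_generated :: "('a, 'b) monoid_scheme \<Rightarrow> 'a set \<Rightarrow> 'a set" where
  "inverse_submonoid_generated M A = \<Inter>{N. inverse_submonoid N M \<and> A \<subseteq> N}"

definition congruence :: "('a, 'b) monoid_scheme \<Rightarrow> ('a \<times> 'a) set \<Rightarrow> bool" where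
  "congruence M \<rho> \<longleftrightarrow> equiv (carrier M) \<rho> \<and>
     (\<forall>a b c d. (a, b) \<in> \<rho> \<longrightarrow> (c, d) \<in> \<rho> \<longrightarrow> (a \<otimes>\<^bsub>M\<^esub> c, b \<otimes>\<^bsub>M\<^esub> d) \<in> \<rho>)"

text \<open>The product of two classes as a set of products need not be a whole class, so it is
  saturated under \<open>\<rho>\<close>.\<close>

definition quotient_monoid :: "('a, 'b) monoid_scheme \<Rightarrow> ('a \<times> 'a) set \<Rightarrow> 'a set monoid" where
  "quotient_monoid M \<rho> =
     \<lparr>carrier = carrier M // \<rho>, mult = (\<lambda>A B. \<rho> `` (A <#>\<^bsub>M\<^esub> B)), one = \<rho> `` {\<one>\<^bsub>M\<^esub>}\<rparr>"

definition group_congruence :: "('a, 'b) monoid_scheme \<Rightarrow> ('a \<times> 'a) set \<Rightarrow> bool" where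
  "group_congruence M \<rho> \<longleftrightarrow> congruence M \<rho> \<and> group (quotient_monoid M \<rho>)"

text \<open>Least with respect to inclusion; lemma \<open>min_group_congruence_least\<close> below shows that
  it exists for every inverse monoid.\<close>

definition min_group_congruence :: "('a, 'b) monoid_scheme \<Rightarrow> ('a \<times> 'a) set" where
  "min_group_congruence M = (LEAST \<rho>. group_congruence M \<rho>)"

definition E_unitary :: "('a, 'b) monoid_scheme \<Rightarrow> bool" where
  "E_unitary M \<longleftrightarrow> (\<forall>m\<in>carrier M. (m, \<one>\<^bsub>M\<^esub>) \<in> min_group_congruence M \<longleftrightarrow> m \<in> idems M)"

definition natural_order :: "('a, 'b) monoid_scheme \<Rightarrow> 'a gorder" where
  "natural_order M =
     \<lparr>carrier = carrier M, eq = (=), le = (\<lambda>x y. \<exists>e\<in>idems M. x = y \<otimes>\<^bsub>M\<^esub> e)\<rparr>"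

definition meet_defined :: "('a, 'b) monoid_scheme \<Rightarrow> 'a \<Rightarrow> 'a \<Rightarrow> bool" where
  "meet_defined M x y \<longleftrightarrow>
     (\<exists>z. greatest (natural_order M) z (Lower (natural_order M) {x, y}))"

definition upwardly_directed_into :: "'a set \<Rightarrow> ('a, 'b) monoid_scheme \<Rightarrow> bool" where
  "upwardly_directed_into N M \<longleftrightarrow> inverse_subsemigroup N M \<and>
     (\<forall>s\<in>carrier M. \<forall>u\<in>N. meet_defined M s u \<longrightarrow>
        (\<exists>v\<in>N \<union> {\<one>\<^bsub>M\<^esub>}. s \<sqsubseteq>\<^bsub>natural_order M\<^esub> v \<and> u \<sqsubseteq>\<^bsub>natural_order M\<^esub> v))"

lemma quotient_mult:
  assumes "congruence M \<rho>" "a \<in> carrier M" "b \<in> carrier M"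
  shows "\<rho> `` {a} \<otimes>\<^bsub>quotient_monoid M \<rho>\<^esub> \<rho> `` {b} = \<rho> `` {a \<otimes>\<^bsub>M\<^esub> b}"
proof -
  have eq: "equiv (carrier M) \<rho>" and
    cg: "\<And>a b c d. (a, b) \<in> \<rho> \<Longrightarrow> (c, d) \<in> \<rho> \<Longrightarrow> (a \<otimes>\<^bsub>M\<^esub> c, b \<otimes>\<^bsub>M\<^esub> d) \<in> \<rho>"
    using assms(1) by (auto simp: congruence_def)
  have tr: "(x, z) \<in> \<rho>" if "(x, y) \<in> \<rho>" "(y, z) \<in> \<rho>" for x y z
    using eq that by (meson equivE transD)
  have rf: "(x, x) \<in> \<rho>" if "x \<in> carrier M" for x
    using eq that by (meson equivE refl_onD)
  show ?thesis
    using assms(2,3) by (auto simp: quotient_monoid_def set_mult_def intro: cg tr rf)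
qed

lemma (in inverse_monoid) group_congruence_iff:
  "group_congruence M \<rho> \<longleftrightarrow> congruence M \<rho> \<and> (\<forall>e\<in>idems M. (e, \<one>) \<in> \<rho>)"
proof (cases "congruence M \<rho>")
  case True
  let ?Q = "quotient_monoid M \<rho>"
  have eq: "equiv (carrier M) \<rho>" using True by (simp add: congruence_def)
  have car: "carrier ?Q = carrier M // \<rho>" and one: "\<one>\<^bsub>?Q\<^esub> = \<rho> `` {\<one>}"
    by (simp_all add: quotient_monoid_def)
  note mu = quotient_mult[OF True]
  have inQ: "x \<in> carrier M \<Longrightarrow> \<rho> `` {x} \<in> carrier ?Q" for x
    by (simp add: car quotientI)
  show ?thesis
  proof (intro iffI conjI ballI True)
    fix e assume "group_congruence M \<rho>" and e: "e \<in> idems M"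
    then interpret Q: group ?Q by (simp add: group_congruence_def)
    have ec: "e \<in> carrier M" and "e \<otimes> e = e" using e by (auto simp: idems_def)
    then have "\<rho> `` {e} \<otimes>\<^bsub>?Q\<^esub> \<rho> `` {e} = \<rho> `` {e}" using mu by simp
    then have "\<rho> `` {e} = \<rho> `` {\<one>}" using Q.l_cancel_one[OF inQ[OF ec] inQ[OF ec]] one by simp
    then show "(e, \<one>) \<in> \<rho>" using eq_equiv_class_iff[OF eq ec one_closed] by simp
  next
    assume "congruence M \<rho> \<and> (\<forall>e\<in>idems M. (e, \<one>) \<in> \<rho>)"
    then have idm: "\<And>e. e \<in> idems M \<Longrightarrow> \<rho> `` {e} = \<rho> `` {\<one>}"
      using equiv_class_eq[OF eq] by blast
    have "group ?Q"
    proof (rule groupI)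
      show "\<one>\<^bsub>?Q\<^esub> \<in> carrier ?Q" using inQ one by simp
      fix X assume "X \<in> carrier ?Q"
      then obtain x where x: "x \<in> carrier M" "X = \<rho> `` {x}" by (auto simp: car elim: quotientE)
      show "\<one>\<^bsub>?Q\<^esub> \<otimes>\<^bsub>?Q\<^esub> X = X" using x one mu by simp
      obtain y where y: "is_sinv M x y" using ex1_sinv x by blast
      then have yc: "y \<in> carrier M" by (simp add: is_sinv_def)
      have "y \<otimes> x \<in> idems M" using x y yc by (simp add: idems_def is_sinv_def m_assoc[symmetric])
      then have "\<rho> `` {y} \<otimes>\<^bsub>?Q\<^esub> X = \<one>\<^bsub>?Q\<^esub>" using idm mu[OF yc x(1)] x one by simp
      then show "\<exists>Y\<in>carrier ?Q. Y \<otimes>\<^bsub>?Q\<^esub> X = \<one>\<^bsub>?Q\<^esub>" using inQ yc by blast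
      fix Y assume "Y \<in> carrier ?Q"
      then obtain y where y: "y \<in> carrier M" "Y = \<rho> `` {y}" by (auto simp: car elim: quotientE)
      show "X \<otimes>\<^bsub>?Q\<^esub> Y \<in> carrier ?Q" using x y mu inQ by simp
      fix Z assume "Z \<in> carrier ?Q"
      then obtain z where z: "z \<in> carrier M" "Z = \<rho> `` {z}" by (auto simp: car elim: quotientE)
      show "X \<otimes>\<^bsub>?Q\<^esub> Y \<otimes>\<^bsub>?Q\<^esub> Z = X \<otimes>\<^bsub>?Q\<^esub> (Y \<otimes>\<^bsub>?Q\<^esub> Z)"
        using x y z mu by (simp add: m_assoc)
    qed
    then show "group_congruence M \<rho>" using True by (simp add: group_congruence_def)
  qed
qed (simp add: group_congruence_def)

lemma (in inverse_monoid) min_group_congruence_least: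
  "group_congruence M (min_group_congruence M)"
  "group_congruence M \<rho> \<Longrightarrow> min_group_congruence M \<subseteq> \<rho>"
proof -
  let ?S = "\<Inter>{\<rho>. group_congruence M \<rho>}"
  have top: "group_congruence M (carrier M \<times> carrier M)"
    by (auto simp: group_congruence_iff congruence_def equiv_def refl_on_def sym_def trans_def
        idems_def)
  have "congruence M ?S"
    unfolding congruence_def
  proof (intro conjI equivI allI impI)
    show "?S \<subseteq> carrier M \<times> carrier M" using top by blast
    show "refl_on (carrier M) ?S"
      by (auto simp: refl_on_def group_congruence_def congruence_def equiv_def)
    show "sym ?S"
      by (auto simp: sym_def group_congruence_def congruence_def equiv_def)
    show "trans ?S"
      by (auto simp: group_congruence_def congruence_def equiv_def intro!: trans_INTER[of _ id, simplified])
    fix a b c d assume "(a, b) \<in> ?S" "(c, d) \<in> ?S"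
    then show "(a \<otimes> c, b \<otimes> d) \<in> ?S" by (auto simp: group_congruence_def congruence_def)
  qed
  then have S: "group_congruence M ?S"
    by (auto simp: group_congruence_iff)
  have "min_group_congruence M = ?S"
    unfolding min_group_congruence_def by (rule Least_equality) (use S in blast)+
  then show "group_congruence M (min_group_congruence M)"
    "group_congruence M \<rho> \<Longrightarrow> min_group_congruence M \<subseteq> \<rho>"
    using S by auto
qed

end

theory Submission
  imports Defs
begin

text \<open>In an \<open>E\<close>-unitary inverse monoid a one-sided unit \<open>v\<close> is the greatest
  element of its \<open>\<sigma>\<close>-class: if \<open>s \<sigma> v\<close> and, say, \<open>v v\<inverse> = 1\<close>, then
  \<open>v\<inverse> s\<close> is an idempotent \<open>e\<close> and \<open>s = v v\<inverse> s = v e \<le> v\<close>. If \<open>s \<and> u\<close> is defined then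
  \<open>s \<sigma> u\<close>, so it suffices that every \<open>u \<in> N\<close> lies below a one-sided unit in \<open>N \<union> {1}\<close>:
  \<open>u\<close> itself in case (1), \<open>1\<close> in case (2), and in cases (3) and (4) a power of the
  generator or of its inverse, because \<open>r\<^sup>-\<^sup>m r\<^sup>n \<le> r\<^sup>n\<^sup>-\<^sup>m\<close> if \<open>r r\<inverse> = 1\<close>.\<close>

context inverse_monoid
begin

section \<open>Inverses and idempotents of an inverse monoid\<close>

lemma sinv_eqI: "x \<in> carrier M \<Longrightarrow> is_sinv M x y \<Longrightarrow> sinv M x = y"
  unfolding sinv_def using ex1_sinv by (rule the1_equality)

lemma is_sinv_sinv: "x \<in> carrier M \<Longrightarrow> is_sinv M x (sinv M x)"
  unfolding sinv_def using ex1_sinv by (rule theI')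

lemma sinv_closed [simp, intro]: "x \<in> carrier M \<Longrightarrow> sinv M x \<in> carrier M"
  using is_sinv_sinv by (simp add: is_sinv_def)

lemma mult_sinv_mult [simp]: "x \<in> carrier M \<Longrightarrow> x \<otimes> (sinv M x \<otimes> x) = x"
  using is_sinv_sinv[of x] by (simp add: is_sinv_def m_assoc)

lemma sinv_mult_sinv [simp]: "x \<in> carrier M \<Longrightarrow> sinv M x \<otimes> (x \<otimes> sinv M x) = sinv M x"
  using is_sinv_sinv[of x] by (simp add: is_sinv_def m_assoc)

lemma sinv_sinv [simp]: "x \<in> carrier M \<Longrightarrow> sinv M (sinv M x) = x"
  by (rule sinv_eqI) (auto simp: is_sinv_def m_assoc)

lemma idems_closed [dest]: "e \<in> idems M \<Longrightarrow> e \<in> carrier M"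
  by (simp add: idems_def)

lemma idems_idem: "e \<in> idems M \<Longrightarrow> e \<otimes> e = e"
  by (simp add: idems_def)

lemma one_idem [simp]: "\<one> \<in> idems M"
  by (simp add: idems_def)

lemma sinv_idem: "e \<in> idems M \<Longrightarrow> sinv M e = e"
  by (rule sinv_eqI) (auto simp: is_sinv_def idems_def)

lemma sinv_one [simp]: "sinv M \<one> = \<one>"
  by (simp add: sinv_idem)

lemma mult_sinv_idem: "x \<in> carrier M \<Longrightarrow> x \<otimes> sinv M x \<in> idems M"
  by (simp add: idems_def m_assoc)

lemma sinv_mult_idem: "x \<in> carrier M \<Longrightarrow> sinv M x \<otimes> x \<in> idems M"
  by (simp add: idems_def m_assoc)

text \<open>If \<open>x\<close> is the inverse of \<open>e \<otimes> f\<close>, then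
  \<open>f \<otimes> (x \<otimes> e)\<close> is another inverse, so uniqueness makes the two equal.
  In this form \<open>x\<close> is visibly idempotent, hence its own inverse, and so it coincides
  with \<open>e \<otimes> f\<close>.\<close>

lemma idems_mult_closed:
  assumes e: "e \<in> idems M" and f: "f \<in> idems M"
  shows "e \<otimes> f \<in> idems M"
proof -
  define x where "x = sinv M (e \<otimes> f)"
  have [simp]: "e \<in> carrier M" "f \<in> carrier M" "x \<in> carrier M"
    using e f by (auto simp: x_def)
  have [simp]: "e \<otimes> (e \<otimes> y) = e \<otimes> y" "f \<otimes> (f \<otimes> y) = f \<otimes> y"
    if "y \<in> carrier M" for y
    using that e f idems_idem by (simp_all add: m_assoc[symmetric])
  have x: "is_sinv M (e \<otimes> f) x" using is_sinv_sinv by (simp add: x_def)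
  then have 1: "e \<otimes> (f \<otimes> (x \<otimes> (e \<otimes> f))) = e \<otimes> f" and 2: "x \<otimes> (e \<otimes> (f \<otimes> x)) = x"
    by (simp_all add: is_sinv_def m_assoc)
  \<comment> \<open>This is fact 2 multiplied by \<open>e\<close> on the right. It gives one of the
    two inverse laws for \<open>f \<otimes> (x \<otimes> e)\<close> and, below, its
    idempotence.\<close>
  have 3: "x \<otimes> (e \<otimes> (f \<otimes> (x \<otimes> e))) = x \<otimes> e"
  proof -
    have "x \<otimes> (e \<otimes> (f \<otimes> (x \<otimes> e))) = x \<otimes> (e \<otimes> (f \<otimes> x)) \<otimes> e" by (simp add: m_assoc)
    then show ?thesis using 2 by simp
  qed
  have "is_sinv M (e \<otimes> f) (f \<otimes> (x \<otimes> e))"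
    using 1 3 by (simp add: is_sinv_def m_assoc)
  then have fxe: "f \<otimes> (x \<otimes> e) = x" using sinv_eqI[of "e \<otimes> f"] by (metis x_def m_closed e f idems_closed)
  have "f \<otimes> (x \<otimes> e) \<otimes> (f \<otimes> (x \<otimes> e)) = f \<otimes> (x \<otimes> e)"
    using 3 by (simp add: m_assoc)
  then have xid: "x \<in> idems M" using fxe by (simp add: idems_def)
  have "sinv M x = e \<otimes> f" by (simp add: x_def)
  with xid show ?thesis by (simp add: sinv_idem)
qed

text \<open>Since both products are idempotent, \<open>f \<otimes> e\<close> is an inverse of
  \<open>e \<otimes> f\<close>; but the idempotent \<open>e \<otimes> f\<close> is also its own
  inverse, so uniqueness applies.\<close>

lemma idems_commute:
  assumes e: "e \<in> idems M" and f: "f \<in> idems M"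
  shows "e \<otimes> f = f \<otimes> e"
proof -
  have [simp]: "e \<in> carrier M" "f \<in> carrier M" using e f by auto
  have [simp]: "e \<otimes> (e \<otimes> y) = e \<otimes> y" "f \<otimes> (f \<otimes> y) = f \<otimes> y"
    if "y \<in> carrier M" for y
    using that e f idems_idem by (simp_all add: m_assoc[symmetric])
  have "e \<otimes> f \<in> idems M" "f \<otimes> e \<in> idems M" using e f idems_mult_closed by auto
  then have "e \<otimes> (f \<otimes> (e \<otimes> f)) = e \<otimes> f" "f \<otimes> (e \<otimes> (f \<otimes> e)) = f \<otimes> e"
    by (simp_all add: idems_def m_assoc)
  then have "is_sinv M (e \<otimes> f) (f \<otimes> e)" by (simp add: is_sinv_def m_assoc)
  then show ?thesis
    using sinv_eqI[of "e \<otimes> f" "f \<otimes> e"] sinv_idem[OF \<open>e \<otimes> f \<in> idems M\<close>] by simp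
qed

text \<open>Because \<open>e\<close> commutes with the idempotent
  \<open>x \<otimes> sinv M x\<close>, it can be carried from the left of \<open>x\<close> to the
  right, where it becomes its conjugate. This links the left and right descriptions of the natural
  order.\<close>

lemma conj_idem:
  assumes e: "e \<in> idems M" and [simp]: "x \<in> carrier M"
  shows "sinv M x \<otimes> (e \<otimes> x) \<in> idems M" "x \<otimes> (sinv M x \<otimes> (e \<otimes> x)) = e \<otimes> x"
proof -
  have [simp]: "e \<in> carrier M" using e by auto
  have "x \<otimes> (sinv M x \<otimes> (e \<otimes> x)) = x \<otimes> sinv M x \<otimes> e \<otimes> x" by (simp add: m_assoc)
  also have "\<dots> = e \<otimes> (x \<otimes> sinv M x) \<otimes> x"
    using idems_commute[OF mult_sinv_idem e] by simp
  also have "\<dots> = e \<otimes> x" by (simp add: m_assoc)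
  finally show *: "x \<otimes> (sinv M x \<otimes> (e \<otimes> x)) = e \<otimes> x" .
  have "e \<otimes> (e \<otimes> x) = e \<otimes> x" using e idems_idem by (simp add: m_assoc[symmetric])
  then show "sinv M x \<otimes> (e \<otimes> x) \<in> idems M" using * by (simp add: idems_def m_assoc)
qed

lemma sinv_mult:
  assumes [simp]: "x \<in> carrier M" "y \<in> carrier M"
  shows "sinv M (x \<otimes> y) = sinv M y \<otimes> sinv M x"
proof (rule sinv_eqI)
  let ?x = "sinv M x" and ?y = "sinv M y"
  \<comment> \<open>Swapping these two idempotents brings \<open>?x \<otimes> x\<close> next to
    \<open>x\<close> and \<open>y \<otimes> ?y\<close> next to \<open>y\<close>, where each is
    absorbed.\<close>
  have c: "?x \<otimes> x \<otimes> (y \<otimes> ?y) = y \<otimes> ?y \<otimes> (?x \<otimes> x)"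
    by (rule idems_commute) (simp_all add: mult_sinv_idem sinv_mult_idem)
  have "x \<otimes> y \<otimes> (?y \<otimes> ?x) \<otimes> (x \<otimes> y) = x \<otimes> (y \<otimes> ?y \<otimes> (?x \<otimes> x)) \<otimes> y"
    by (simp add: m_assoc)
  also have "\<dots> = (x \<otimes> (?x \<otimes> x)) \<otimes> (y \<otimes> (?y \<otimes> y))"
    unfolding c[symmetric] by (simp add: m_assoc del: mult_sinv_mult)
  finally have 1: "x \<otimes> y \<otimes> (?y \<otimes> ?x) \<otimes> (x \<otimes> y) = x \<otimes> y" by simp
  have "?y \<otimes> ?x \<otimes> (x \<otimes> y) \<otimes> (?y \<otimes> ?x) = ?y \<otimes> (?x \<otimes> x \<otimes> (y \<otimes> ?y)) \<otimes> ?x"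
    by (simp add: m_assoc)
  also have "\<dots> = (?y \<otimes> (y \<otimes> ?y)) \<otimes> (?x \<otimes> (x \<otimes> ?x))"
    unfolding c by (simp add: m_assoc del: sinv_mult_sinv)
  finally have 2: "?y \<otimes> ?x \<otimes> (x \<otimes> y) \<otimes> (?y \<otimes> ?x) = ?y \<otimes> ?x" by simp
  show "is_sinv M (x \<otimes> y) (?y \<otimes> ?x)" using 1 2 by (simp add: is_sinv_def)
qed simp

lemma sinv_pow: "x \<in> carrier M \<Longrightarrow> sinv M (x [^] n) = sinv M x [^] (n::nat)"
proof (induction n)
  case (Suc n)
  then show ?case
    using nat_pow_Suc2[of "sinv M x" n] by (simp add: sinv_mult)
qed simp

section \<open>The natural partial order and its compatibility with the operations\<close>

lemma natural_le_iff: "x \<sqsubseteq>\<^bsub>natural_order M\<^esub> y \<longleftrightarrow> (\<exists>e\<in>idems M. x = y \<otimes> e)"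
  by (simp add: natural_order_def)

lemma natural_leI_right: "e \<in> idems M \<Longrightarrow> y \<otimes> e \<sqsubseteq>\<^bsub>natural_order M\<^esub> y"
  by (auto simp: natural_le_iff)

lemma natural_leI_left: "e \<in> idems M \<Longrightarrow> y \<in> carrier M \<Longrightarrow> e \<otimes> y \<sqsubseteq>\<^bsub>natural_order M\<^esub> y"
  using natural_leI_right[OF conj_idem(1), of e y y] by (simp add: conj_idem(2))

lemma natural_le_refl: "x \<in> carrier M \<Longrightarrow> x \<sqsubseteq>\<^bsub>natural_order M\<^esub> x"
  using natural_leI_right[of \<one> x] by simp

lemma natural_le_trans:
  assumes "x \<sqsubseteq>\<^bsub>natural_order M\<^esub> y" "y \<sqsubseteq>\<^bsub>natural_order M\<^esub> z" "z \<in> carrier M"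
  shows "x \<sqsubseteq>\<^bsub>natural_order M\<^esub> z"
proof -
  obtain e f where "e \<in> idems M" "f \<in> idems M" "x = z \<otimes> (f \<otimes> e)"
    using assms by (auto simp: natural_le_iff m_assoc idems_closed)
  then show ?thesis using idems_mult_closed natural_leI_right by simp
qed

lemma natural_le_mult:
  assumes "x \<sqsubseteq>\<^bsub>natural_order M\<^esub> y" "x' \<sqsubseteq>\<^bsub>natural_order M\<^esub> y'"
    and [simp]: "y \<in> carrier M" "y' \<in> carrier M"
  shows "x \<otimes> x' \<sqsubseteq>\<^bsub>natural_order M\<^esub> y \<otimes> y'"
proof -
  obtain e f where e: "e \<in> idems M" "x = y \<otimes> e" and f: "f \<in> idems M" "x' = y' \<otimes> f"
    using assms(1,2) by (auto simp: natural_le_iff)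
  note [simp] = idems_closed[OF e(1)] idems_closed[OF f(1)]
  \<comment> \<open>Carrying \<open>e\<close> past \<open>y'\<close> turns it into some idempotent
    \<open>g\<close>, so that both idempotents collect on the right of
    \<open>y \<otimes> y'\<close>.\<close>
  obtain g where g: "g \<in> idems M" "e \<otimes> y' = y' \<otimes> g"
    using natural_leI_left[OF e(1), of y'] by (auto simp: natural_le_iff)
  note [simp] = idems_closed[OF g(1)]
  have "x \<otimes> x' = y \<otimes> (e \<otimes> y') \<otimes> f" using e f by (simp add: m_assoc)
  also have "\<dots> = y \<otimes> y' \<otimes> (g \<otimes> f)" unfolding g(2) by (simp add: m_assoc)
  finally show ?thesis
    using natural_leI_right[OF idems_mult_closed[OF g(1) f(1)]] by simp
qed

text \<open>Inversion reverses products and fixes idempotents, so the factor \<open>e\<close> moves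
  to the left of \<open>sinv M y\<close>, where \<open>natural_leI_left\<close> handles it.\<close>

lemma natural_le_sinv:
  assumes "x \<sqsubseteq>\<^bsub>natural_order M\<^esub> y" "y \<in> carrier M"
  shows "sinv M x \<sqsubseteq>\<^bsub>natural_order M\<^esub> sinv M y"
proof -
  obtain e where "e \<in> idems M" "x = y \<otimes> e" using assms(1) by (auto simp: natural_le_iff)
  then show ?thesis
    using assms(2) natural_leI_left by (simp add: sinv_mult sinv_idem idems_closed)
qed

section \<open>The minimum group congruence \<sigma>\<close>

lemma sigma_congruence:
  shows sigma_refl: "x \<in> carrier M \<Longrightarrow> (x, x) \<in> min_group_congruence M"
    and sigma_sym: "(x, y) \<in> min_group_congruence M \<Longrightarrow> (y, x) \<in> min_group_congruence M"
    and sigma_trans: "(x, y) \<in> min_group_congruence M \<Longrightarrow> (y, z) \<in> min_group_congruence M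
      \<Longrightarrow> (x, z) \<in> min_group_congruence M"
    and sigma_mult: "(x, y) \<in> min_group_congruence M \<Longrightarrow> (x', y') \<in> min_group_congruence M
      \<Longrightarrow> (x \<otimes> x', y \<otimes> y') \<in> min_group_congruence M"
    and sigma_idem: "e \<in> idems M \<Longrightarrow> (e, \<one>) \<in> min_group_congruence M"
proof -
  have c: "congruence M (min_group_congruence M)"
    and i: "\<And>e. e \<in> idems M \<Longrightarrow> (e, \<one>) \<in> min_group_congruence M"
    using min_group_congruence_least(1) by (auto simp: group_congruence_iff)
  then have eq: "equiv (carrier M) (min_group_congruence M)" by (simp add: congruence_def)
  show "x \<in> carrier M \<Longrightarrow> (x, x) \<in> min_group_congruence M"
    using eq by (meson equivE refl_onD)
  show "(x, y) \<in> min_group_congruence M \<Longrightarrow> (y, x) \<in> min_group_congruence M"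
    using eq by (meson equivE symD)
  show "(x, y) \<in> min_group_congruence M \<Longrightarrow> (y, z) \<in> min_group_congruence M
      \<Longrightarrow> (x, z) \<in> min_group_congruence M"
    using eq by (meson equivE transD)
  show "(x, y) \<in> min_group_congruence M \<Longrightarrow> (x', y') \<in> min_group_congruence M
      \<Longrightarrow> (x \<otimes> x', y \<otimes> y') \<in> min_group_congruence M"
    using c by (simp add: congruence_def)
  show "e \<in> idems M \<Longrightarrow> (e, \<one>) \<in> min_group_congruence M" by (rule i)
qed

text \<open>Comparable elements differ by an idempotent factor, and \<sigma> identifies every
  idempotent with 1.\<close>

lemma natural_le_sigma:
  assumes "x \<sqsubseteq>\<^bsub>natural_order M\<^esub> y" "y \<in> carrier M"
  shows "(x, y) \<in> min_group_congruence M"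
proof -
  obtain e where "e \<in> idems M" "x = y \<otimes> e" using assms(1) by (auto simp: natural_le_iff)
  then show ?thesis
    using sigma_mult[OF sigma_refl sigma_idem, of y e] assms(2) by simp
qed

text \<open>The meet is a common lower bound, and both elements are \<sigma>-related to it.\<close>

lemma meet_defined_sigma:
  assumes "meet_defined M x y" and x: "x \<in> carrier M" and y: "y \<in> carrier M"
  shows "(x, y) \<in> min_group_congruence M"
proof -
  obtain z where "z \<in> Lower (natural_order M) {x, y}"
    using assms(1) by (auto simp: meet_defined_def greatest_def)
  then have "z \<sqsubseteq>\<^bsub>natural_order M\<^esub> x" "z \<sqsubseteq>\<^bsub>natural_order M\<^esub> y"
    using x y by (auto simp: Lower_def natural_order_def)
  then show ?thesis using natural_le_sigma sigma_sym sigma_trans x y by meson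
qed

section \<open>One-sided units as upper bounds in an E-unitary monoid\<close>

lemma E_unitary_le_unit:
  assumes E: "E_unitary M" and sv: "(s, v) \<in> min_group_congruence M"
    and [simp]: "s \<in> carrier M" and v: "v \<in> right_units M \<union> left_units M"
  shows "s \<sqsubseteq>\<^bsub>natural_order M\<^esub> v"
  using v
proof
  assume "v \<in> right_units M"
  then have [simp]: "v \<in> carrier M" and v1: "v \<otimes> sinv M v = \<one>" by (auto simp: right_units_def)
  have "(sinv M v \<otimes> s, sinv M v \<otimes> v) \<in> min_group_congruence M"
    using sv by (simp add: sigma_mult sigma_refl)
  \<comment> \<open>The element \<open>sinv M v \<otimes> v\<close> is an idempotent, so \<sigma>
    relates it to 1.\<close>
  then have "(sinv M v \<otimes> s, \<one>) \<in> min_group_congruence M"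
    using sigma_trans sigma_idem[OF sinv_mult_idem] \<open>v \<in> carrier M\<close> by blast
  then have "sinv M v \<otimes> s \<in> idems M" using E by (simp add: E_unitary_def)
  moreover have "v \<otimes> (sinv M v \<otimes> s) = s" using v1 by (simp add: m_assoc[symmetric])
  ultimately show ?thesis using natural_leI_right by metis
next
  assume "v \<in> left_units M"
  then have [simp]: "v \<in> carrier M" and v1: "sinv M v \<otimes> v = \<one>" by (auto simp: left_units_def)
  \<comment> \<open>The dual argument: the idempotent is now \<open>s \<otimes> sinv M v\<close>,
    and it stands to the left of \<open>v\<close>.\<close>
  have "(s \<otimes> sinv M v, v \<otimes> sinv M v) \<in> min_group_congruence M"
    using sv by (simp add: sigma_mult sigma_refl)
  then have "(s \<otimes> sinv M v, \<one>) \<in> min_group_congruence M"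
    using sigma_trans sigma_idem[OF mult_sinv_idem] \<open>v \<in> carrier M\<close> by blast
  then have "s \<otimes> sinv M v \<in> idems M" using E by (simp add: E_unitary_def)
  moreover have "s \<otimes> sinv M v \<otimes> v = s" using v1 by (simp add: m_assoc)
  ultimately show ?thesis using natural_leI_left \<open>v \<in> carrier M\<close> by metis
qed

lemma upwardly_directed_intoI:
  assumes "E_unitary M" and N: "inverse_subsemigroup N M"
    and up: "\<And>u. u \<in> N \<Longrightarrow> \<exists>v\<in>N \<union> {\<one>}. v \<in> right_units M \<union> left_units M \<and> u \<sqsubseteq>\<^bsub>natural_order M\<^esub> v"
  shows "upwardly_directed_into N M"
  unfolding upwardly_directed_into_def
proof (intro conjI N ballI impI)
  fix s u assume s: "s \<in> carrier M" and u: "u \<in> N" and m: "meet_defined M s u"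
  obtain v where v: "v \<in> N \<union> {\<one>}" "v \<in> right_units M \<union> left_units M" "u \<sqsubseteq>\<^bsub>natural_order M\<^esub> v"
    using up u by blast
  have "u \<in> carrier M" "v \<in> carrier M" using N u v(1) by (auto simp: inverse_subsemigroup_def)
  \<comment> \<open>The chain runs through \<open>u\<close>: the meet relates \<open>s\<close> to
    \<open>u\<close>, and \<open>u\<close> is related to \<open>v\<close> because it lies below
    \<open>v\<close>.\<close>
  then have "(s, v) \<in> min_group_congruence M"
    using meet_defined_sigma[OF m s] natural_le_sigma[OF v(3)] sigma_trans by blast
  then have "s \<sqsubseteq>\<^bsub>natural_order M\<^esub> v" using E_unitary_le_unit assms(1) s v(2) by blast
  with v show "\<exists>v\<in>N \<union> {\<one>}. s \<sqsubseteq>\<^bsub>natural_order M\<^esub> v \<and> u \<sqsubseteq>\<^bsub>natural_order M\<^esub> v" by blast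
qed

section \<open>Powers of a right unit and the submonoids they generate\<close>

lemma right_unit_pow_cancel:
  assumes "r \<in> right_units M"
  shows "r [^] n \<otimes> sinv M r [^] (n::nat) = \<one>"
proof (induction n)
  case (Suc n)
  have [simp]: "r \<in> carrier M" and r1: "r \<otimes> sinv M r = \<one>"
    using assms by (auto simp: right_units_def)
  \<comment> \<open>The power of \<open>r\<close> is split at its right end and that of
    \<open>sinv M r\<close> at its left end, so the cancelling pair meets in the middle.\<close>
  have "r [^] Suc n \<otimes> sinv M r [^] Suc n = r [^] n \<otimes> (r \<otimes> sinv M r) \<otimes> sinv M r [^] n"
    by (simp only: nat_pow_Suc2[OF sinv_closed[OF \<open>r \<in> carrier M\<close>]]) (simp add: m_assoc)
  also have "\<dots> = \<one>" using Suc r1 by simp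
  finally show ?case .
qed simp

text \<open>These are the powers of \<open>r\<close> with integer exponents, negative ones being
  taken with \<open>sinv\<close>. For a right unit \<open>r\<close> they serve as the upper bounds
  of the elements that \<open>r\<close> generates.\<close>

definition signed_powers :: "'a \<Rightarrow> 'a set" where
  "signed_powers r = range (\<lambda>n::nat. r [^] n) \<union> range (\<lambda>n::nat. sinv M r [^] n)"

lemma signed_powers_closed: "r \<in> carrier M \<Longrightarrow> signed_powers r \<subseteq> carrier M"
  by (auto simp: signed_powers_def)

text \<open>The exponents add, up to the order: a product in which \<open>r\<close> precedes its
  inverse cancels exactly, while the opposite order leaves an idempotent that can only be bounded by
  1.\<close>

lemma signed_powers_mult:
  assumes r: "r \<in> right_units M" and "x \<in> signed_powers r" "y \<in> signed_powers r"
  shows "\<exists>z\<in>signed_powers r. x \<otimes> y \<sqsubseteq>\<^bsub>natural_order M\<^esub> z"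
proof -
  have [simp]: "r \<in> carrier M" using r by (simp add: right_units_def)
  let ?r = "sinv M r"
  have pos: "r [^] n \<in> signed_powers r" and neg: "?r [^] n \<in> signed_powers r" for n :: nat
    by (auto simp: signed_powers_def)
  have idem: "?r [^] n \<otimes> r [^] n \<in> idems M" for n :: nat
    using sinv_mult_idem[of "r [^] n"] by (simp add: sinv_pow)
  have same: "\<exists>z\<in>signed_powers r. w \<sqsubseteq>\<^bsub>natural_order M\<^esub> z" if "w \<in> signed_powers r" for w
    using that natural_le_refl signed_powers_closed[of r] by auto
  have mixed: "\<exists>z\<in>signed_powers r. r [^] m \<otimes> ?r [^] n \<sqsubseteq>\<^bsub>natural_order M\<^esub> z" for m n :: nat
  proof (cases "n \<le> m")
    case True
    then have "r [^] m \<otimes> ?r [^] n = r [^] (m - n) \<otimes> r [^] n \<otimes> ?r [^] n"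
      by (simp add: nat_pow_mult)
    also have "\<dots> = r [^] (m - n)" by (simp add: m_assoc right_unit_pow_cancel[OF r])
    finally show ?thesis using same[OF pos] by simp
  next
    case False
    then have "r [^] m \<otimes> ?r [^] n = r [^] m \<otimes> (?r [^] m \<otimes> ?r [^] (n - m))"
      by (simp add: nat_pow_mult)
    also have "\<dots> = ?r [^] (n - m)"
      by (simp add: m_assoc[symmetric] right_unit_pow_cancel[OF r])
    finally show ?thesis using same[OF neg] by simp
  qed
  \<comment> \<open>Splitting the longer power isolates the idempotent
    \<open>?r [^] k \<otimes> r [^] k\<close>, where \<open>k\<close> is the smaller exponent. It
    lies to the left of the remaining power if \<open>m \<le> n\<close> and to the right
    otherwise.\<close>
  have mixed': "\<exists>z\<in>signed_powers r. ?r [^] m \<otimes> r [^] n \<sqsubseteq>\<^bsub>natural_order M\<^esub> z" for m n :: nat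
  proof (cases "m \<le> n")
    case True
    then have "?r [^] m \<otimes> r [^] n = ?r [^] m \<otimes> (r [^] m \<otimes> r [^] (n - m))"
      by (simp add: nat_pow_mult)
    also have "\<dots> = ?r [^] m \<otimes> r [^] m \<otimes> r [^] (n - m)" by (simp add: m_assoc)
    also have "\<dots> \<sqsubseteq>\<^bsub>natural_order M\<^esub> r [^] (n - m)" by (intro natural_leI_left idem) simp
    finally show ?thesis using pos by blast
  next
    case False
    then have "?r [^] m \<otimes> r [^] n = ?r [^] (m - n) \<otimes> ?r [^] n \<otimes> r [^] n"
      by (simp add: nat_pow_mult)
    also have "\<dots> = ?r [^] (m - n) \<otimes> (?r [^] n \<otimes> r [^] n)" by (simp add: m_assoc)
    also have "\<dots> \<sqsubseteq>\<^bsub>natural_order M\<^esub> ?r [^] (m - n)" by (intro natural_leI_right idem)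
    finally show ?thesis using neg by blast
  qed
  \<comment> \<open>There are four sign combinations; products of equal sign are again signed powers
    by addition of exponents.\<close>
  from assms(2,3) show ?thesis
    unfolding signed_powers_def[of r]
    by (elim UnE rangeE; simp only:)
      (use mixed mixed' same pos neg in
        \<open>simp_all add: nat_pow_mult signed_powers_def[symmetric]\<close>)
qed

lemma signed_powers_self: "x \<in> carrier M \<Longrightarrow> x \<in> signed_powers x"
  using rangeI[of "\<lambda>n::nat. x [^] n" 1] by (simp add: signed_powers_def)

lemma signed_powers_sinv:
  "r \<in> carrier M \<Longrightarrow> x \<in> signed_powers r \<Longrightarrow> sinv M x \<in> signed_powers r"
  by (auto simp: signed_powers_def sinv_pow)

text \<open>The identity \<open>r [^] n \<otimes> sinv M r [^] n = \<one>\<close> makes the first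
  factor a right unit and the second a left unit.\<close>

lemma signed_powers_units:
  "r \<in> right_units M \<Longrightarrow> signed_powers r \<subseteq> right_units M \<union> left_units M"
  using right_unit_pow_cancel[of r]
  by (auto simp: signed_powers_def right_units_def left_units_def sinv_pow)

lemma signed_powers_subset:
  assumes N: "inverse_submonoid N M" and r: "r \<in> N"
  shows "signed_powers r \<subseteq> N"
proof -
  have "x [^] n \<in> N" if "x \<in> N" for x and n :: nat
    using N that by (induction n) (auto simp: inverse_submonoid_def inverse_subsemigroup_def)
  then show ?thesis
    using N r by (auto simp: signed_powers_def inverse_submonoid_def inverse_subsemigroup_def)
qed

text \<open>The elements below some signed power form an inverse submonoid containing
  \<open>x\<close>, hence contain everything \<open>x\<close> generates. Keeping the generator
  \<open>x\<close> apart from \<open>r\<close> covers both \<open>x = r\<close> and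
  \<open>x = sinv M r\<close>.\<close>

lemma generated_le_signed_power:
  assumes r: "r \<in> right_units M" and x: "x \<in> signed_powers r"
    and u: "u \<in> inverse_submonoid_generated M {x}"
  shows "\<exists>v\<in>signed_powers r. u \<sqsubseteq>\<^bsub>natural_order M\<^esub> v"
proof -
  have rc: "r \<in> carrier M" using r by (simp add: right_units_def)
  note pc = subsetD[OF signed_powers_closed[OF rc]]
  \<comment> \<open>Closure of \<open>?K\<close> under products combines monotonicity of
    multiplication with \<open>signed_powers_mult\<close>.\<close>
  let ?K = "{u \<in> carrier M. \<exists>v\<in>signed_powers r. u \<sqsubseteq>\<^bsub>natural_order M\<^esub> v}"
  have memI: "y \<in> ?K" if "y \<in> signed_powers r" for y
    using that pc natural_le_refl by blast
  have "\<one> \<in> signed_powers r"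
    unfolding signed_powers_def by (metis UnI1 nat_pow_0 rangeI)
  then have "\<one> \<in> ?K" by (rule memI)
  moreover have "y \<otimes> z \<in> ?K" if yz: "y \<in> ?K" "z \<in> ?K" for y z
  proof -
    obtain v w where v: "v \<in> signed_powers r" "y \<sqsubseteq>\<^bsub>natural_order M\<^esub> v"
      and w: "w \<in> signed_powers r" "z \<sqsubseteq>\<^bsub>natural_order M\<^esub> w" using yz by blast
    obtain t where t: "t \<in> signed_powers r" "v \<otimes> w \<sqsubseteq>\<^bsub>natural_order M\<^esub> t"
      using signed_powers_mult[OF r v(1) w(1)] by blast
    have "y \<otimes> z \<sqsubseteq>\<^bsub>natural_order M\<^esub> t"
      using natural_le_trans[OF natural_le_mult[OF v(2) w(2)] t(2)] v(1) w(1) t(1) pc by blast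
    then show ?thesis using yz t(1) by blast
  qed
  moreover have "sinv M y \<in> ?K" if "y \<in> ?K" for y
    using that natural_le_sinv signed_powers_sinv[OF rc] pc by blast
  ultimately have "inverse_submonoid ?K M"
    unfolding inverse_submonoid_def inverse_subsemigroup_def by blast
  then have "u \<in> ?K"
    using u memI[OF x] unfolding inverse_submonoid_generated_def by blast
  then show ?thesis by blast
qed

lemma generated_upwardly_directed:
  assumes "E_unitary M" and N: "inverse_submonoid N M" and r: "r \<in> right_units M" "r \<in> N"
    and gen: "x \<in> signed_powers r" "N = inverse_submonoid_generated M {x}"
  shows "upwardly_directed_into N M"
proof (rule upwardly_directed_intoI[OF assms(1)])
  show "inverse_subsemigroup N M" using N by (simp add: inverse_submonoid_def)
  fix u assume "u \<in> N"
  then obtain v where "v \<in> signed_powers r" "u \<sqsubseteq>\<^bsub>natural_order M\<^esub> v"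
    using generated_le_signed_power r(1) gen by blast
  then show "\<exists>v\<in>N \<union> {\<one>}. v \<in> right_units M \<union> left_units M \<and> u \<sqsubseteq>\<^bsub>natural_order M\<^esub> v"
    using signed_powers_units[OF r(1)] signed_powers_subset[OF N r(2)] by blast
qed

end

section \<open>Upward directedness for the four kinds of submonoid\<close>

theorem lemma3p2:
  fixes M :: "('a, 'b) monoid_scheme" and N :: "'a set"
  assumes "inverse_monoid M"
    and "E_unitary M"
    and "inverse_submonoid N M"
    and "N \<subseteq> two_sided_units M
       \<or> N \<subseteq> idems M
       \<or> (\<exists>r\<in>right_units M. N = inverse_submonoid_generated M {r})
       \<or> (\<exists>l\<in>left_units M. N = inverse_submonoid_generated M {l})"
  shows "upwardly_directed_into N M"
proof -
  interpret inverse_monoid M by (rule assms(1))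
  have N: "inverse_subsemigroup N M" and Nc: "N \<subseteq> carrier M"
    using assms(3) by (auto simp: inverse_submonoid_def inverse_subsemigroup_def)
  have gen: "x \<in> inverse_submonoid_generated M {x}" for x
    by (auto simp: inverse_submonoid_generated_def)
  from assms(4) consider (units) "N \<subseteq> two_sided_units M" | (idems) "N \<subseteq> idems M"
    | (right) r where "r \<in> right_units M" "N = inverse_submonoid_generated M {r}"
    | (left) l where "l \<in> left_units M" "N = inverse_submonoid_generated M {l}"
    by blast
  then show ?thesis
  proof cases
    case units
    then show ?thesis
      using upwardly_directed_intoI[OF assms(2) N] natural_le_refl Nc
      unfolding two_sided_units_def by blast
  next
    case idems
    have "\<one>\<^bsub>M\<^esub> \<in> right_units M" by (simp add: right_units_def)
    \<comment> \<open>An idempotent \<open>u\<close> is 1 times itself, hence lies below 1.\<close>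
    moreover have "u \<sqsubseteq>\<^bsub>natural_order M\<^esub> \<one>\<^bsub>M\<^esub>" if "u \<in> N" for u
      using subsetD[OF idems that] natural_leI_right[of u "\<one>\<^bsub>M\<^esub>"] by (simp add: idems_closed)
    ultimately show ?thesis
      using upwardly_directed_intoI[OF assms(2) N] by blast
  next
    case right
    then show ?thesis
      using generated_upwardly_directed[OF assms(2,3)] gen signed_powers_self
      by (auto simp: right_units_def)
  next
    case left
    then have l: "l \<in> carrier M" by (simp add: left_units_def)
    \<comment> \<open>The inverse of the left unit \<open>l\<close> takes the role of the right unit
      \<open>r\<close>; the generator \<open>l\<close> is then its signed power with exponent
      -1.\<close>
    have "sinv M l \<in> right_units M" using left(1) by (simp add: left_units_def right_units_def)
    moreover have "sinv M l \<in> N" using N gen[of l] left(2) by (simp add: inverse_subsemigroup_def)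
    moreover have "l \<in> signed_powers (sinv M l)"
      using signed_powers_sinv[OF sinv_closed[OF l] signed_powers_self[OF sinv_closed[OF l]]] l by simp
    ultimately show ?thesis
      using generated_upwardly_directed[OF assms(2,3)] left(2) by blast
  qed
qed

end
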